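(* The error in general summation of real numbers $x_1,\ldots,x_n$ equals $$e_n=\hat{s}_n-s_n=\sum_{k=2}^n s_k\,\delta_k\prod_{k\prec j\preceq n}(1+\delta_j),$$ where for each $k$ the product is over all $j\in\{2,\ldots,n\}$ with $k\prec j\preceq n$.
   Context: General summation of real numbers $x_1,\ldots,x_n$ ($n\ge 2$): start with the multiset $\mathcal{S}=\{x_1,\ldots,x_n\}$; for $k=2,\ldots,n$ remove two elements $x,y$ from $\mathcal{S}$, set $s_k=x+y$, and add $s_k$ to $\mathcal{S}$; the output is $s_n=\sum_{i=1}^n x_i$. The order of summation (which two elements are removed at each step) is fixed in advance. The computational tree is the binary tree with $2n-1$ vertices whose leaves are the inputs $x_1,\ldots,x_n$, whose internal vertices are the exact partial sums $s_2,\ldots,s_n$ (root $s_n$), where the two children of $s_k$ are the two elements $x,y$ with $s_k=x+y$. For $j,k\in\{2,\ldots,n\}$ write $j\prec k$ if the vertex $s_j$ is a (proper) descendant of the vertex $s_k$, and $j\preceq k$ if $j\prec k$ or $j=k$. Floating point model (unit roundoff $0<u<1$, no overflow or underflow): inputs are stored exactly, and if $\hat{x},\hat{y}$ are the computed values of the children of $s_k$ (a leaf has computed value equal to its exact value), the computed value of $s_k$ is $\hat{s}_k=(\hat{x}+\hat{y})(1+\delta_k)$ with $|\delta_k|\le u$, $2\le k\le n$. Empty products equal $1$. *)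

theory Defs
  imports Complex_Main
begin

text \<open>
  The multiset of current summands is modelled as a set of tree vertices rather than of real
  numbers, so that summands with equal values stay distinguishable: \<open>Leaf i\<close> stands for the
  input \<open>x i\<close> (\<open>1 \<le> i \<le> n\<close>), and \<open>Node k\<close> for the sum formed in step \<open>k\<close> (\<open>2 \<le> k \<le> n\<close>).
  An order of summation is a function \<open>c\<close> giving the two summands \<open>c k\<close> removed in step \<open>k\<close>;
  these are the children of \<open>Node k\<close> in the computational tree.
\<close>

datatype vertex = Leaf nat | Node nat

type_synonym schedule = "nat \<Rightarrow> vertex \<times> vertex"

text \<open>\<open>summands n c k\<close> is the collection of summands after step \<open>k\<close>. The first step is number 2.\<close>

fun summands :: "nat \<Rightarrow> schedule \<Rightarrow> nat \<Rightarrow> vertex set" where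
  "summands n c 0 = Leaf ` {1..n}"
| "summands n c (Suc 0) = Leaf ` {1..n}"
| "summands n c (Suc (Suc k)) =
     insert (Node (Suc (Suc k)))
       (summands n c (Suc k) - {fst (c (Suc (Suc k))), snd (c (Suc (Suc k)))})"

definition summation_order :: "nat \<Rightarrow> schedule \<Rightarrow> bool" where
  "summation_order n c \<longleftrightarrow>
     (\<forall>k\<in>{2..n}. fst (c k) \<in> summands n c (k - 1) \<and> snd (c k) \<in> summands n c (k - 1)
        \<and> fst (c k) \<noteq> snd (c k))"

primrec vertex_value :: "(nat \<Rightarrow> real) \<Rightarrow> (nat \<Rightarrow> real) \<Rightarrow> vertex \<Rightarrow> real" where
  "vertex_value x s (Leaf i) = x i"
| "vertex_value x s (Node k) = s k"

definition exact_sums :: "nat \<Rightarrow> schedule \<Rightarrow> (nat \<Rightarrow> real) \<Rightarrow> (nat \<Rightarrow> real) \<Rightarrow> bool" where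
  "exact_sums n c x s \<longleftrightarrow>
     (\<forall>k\<in>{2..n}. s k = vertex_value x s (fst (c k)) + vertex_value x s (snd (c k)))"

definition computed_sums ::
  "nat \<Rightarrow> schedule \<Rightarrow> real \<Rightarrow> (nat \<Rightarrow> real) \<Rightarrow> (nat \<Rightarrow> real) \<Rightarrow> (nat \<Rightarrow> real) \<Rightarrow> bool" where
  "computed_sums n c u x \<delta> s' \<longleftrightarrow>
     (\<forall>k\<in>{2..n}. s' k = (vertex_value x s' (fst (c k)) + vertex_value x s' (snd (c k))) * (1 + \<delta> k)
        \<and> \<bar>\<delta> k\<bar> \<le> u)"

definition child_rel :: "nat \<Rightarrow> schedule \<Rightarrow> (vertex \<times> vertex) set" where
  "child_rel n c = {(v, Node k) | v k. k \<in> {2..n} \<and> (v = fst (c k) \<or> v = snd (c k))}"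

definition descendant :: "nat \<Rightarrow> schedule \<Rightarrow> nat \<Rightarrow> nat \<Rightarrow> bool" where
  "descendant n c j k \<longleftrightarrow> (Node j, Node k) \<in> (child_rel n c)\<^sup>+"

definition descendant_eq :: "nat \<Rightarrow> schedule \<Rightarrow> nat \<Rightarrow> nat \<Rightarrow> bool" where
  "descendant_eq n c j k \<longleftrightarrow> descendant n c j k \<or> j = k"

end

theory Submission
  imports Defs
begin

text \<open>
  Attach to every vertex \<open>v\<close> of the computational tree its error \<open>e v\<close> (computed minus exact
  value) and the amplification factor \<open>W v\<close>, the product of \<open>1 + \<delta> j\<close> over the proper
  ancestors \<open>Node j\<close> of \<open>v\<close>. When step \<open>k\<close> replaces the summands \<open>a\<close> and \<open>b\<close> by their sum, the
  rounding model gives \<open>e (Node k) = (e a + e b) * (1 + \<delta> k) + s k * \<delta> k\<close>. The ancestors of a child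
  are its parent together with the ancestors of the parent, so \<open>W a = W b = (1 + \<delta> k) * W (Node k)\<close>.
  Hence the total of \<open>e v * W v\<close> over the current summands grows by exactly \<open>s k * \<delta> k * W (Node k)\<close>
  in step \<open>k\<close> (\<open>amplified_error_total\<close>). It starts at 0 because inputs are exact, and it ends as the
  error of \<open>Node n\<close>, the only remaining summand, which has no ancestors.

  This needs two facts about the tree. Each vertex has at most one parent (\<open>parent_unique\<close>), because
  a summand that has been removed never comes back. Every summand is a descendant of the root or the
  root itself (\<open>summand_below_root\<close>), so that the condition \<open>descendant_eq n c j n\<close> in the
  theorem excludes no ancestor and the products there are the values of \<open>W\<close>.
\<close>

lemma summands_step:
  assumes "2 \<le> k"
  shows "summands n c k =
    insert (Node k) (summands n c (k - 1) - {fst (c k), snd (c k)})"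
proof -
  obtain i where "k = Suc (Suc i)"
    using assms by (metis add_2_eq_Suc le_Suc_ex)
  then show ?thesis by simp
qed

lemma finite_summands: "finite (summands n c m)"
  by (induction n c m rule: summands.induct) auto

lemma Node_in_summands_index: "Node j \<in> summands n c m \<Longrightarrow> 2 \<le> j \<and> j \<le> m"
  by (induction n c m rule: summands.induct) auto

lemma summation_order_children:
  assumes "summation_order n c" "2 \<le> k" "k \<le> n"
  shows "fst (c k) \<in> summands n c (k - 1)" "snd (c k) \<in> summands n c (k - 1)"
    "fst (c k) \<noteq> snd (c k)"
  using assms by (auto simp: summation_order_def)

text \<open>Each step removes two summands and adds one that is new, as \<open>Node m\<close> has a larger
  index than all earlier nodes.\<close>

lemma card_summands:
  assumes "summation_order n c"
  shows "1 \<le> m \<Longrightarrow> m \<le> n \<Longrightarrow> card (summands n c m) = n + 1 - m"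
proof (induction m rule: dec_induct)
  case base
  then show ?case by (simp add: card_image inj_on_def)
next
  case (step m)
  let ?S = "summands n c m" and ?a = "fst (c (Suc m))" and ?b = "snd (c (Suc m))"
  have ab: "?a \<in> ?S" "?b \<in> ?S" "?a \<noteq> ?b"
    using summation_order_children[OF assms, of "Suc m"] step by auto
  have "Node (Suc m) \<notin> ?S"
    using Node_in_summands_index[of "Suc m" n c m] by auto
  then have "card (summands n c (Suc m)) = Suc (card (?S - {?a, ?b}))"
    using summands_step[of "Suc m" n c] step finite_summands by simp
  also have "card (?S - {?a, ?b}) = card ?S - 2"
    using ab by (subst card_Diff_subset) auto
  finally show ?case using step by auto
qed

lemma final_summands:
  assumes "summation_order n c" "2 \<le> n"
  shows "summands n c n = {Node n}"
proof -
  have "card (summands n c n) = 1"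
    using card_summands[OF assms(1), of n] assms(2) by simp
  moreover have "Node n \<in> summands n c n"
    using summands_step[OF assms(2)] by simp
  ultimately show ?thesis by (auto simp: card_1_singleton_iff)
qed

lemma removed_summand_stays_removed:
  assumes "k \<le> m" "v \<notin> summands n c k" "\<And>j. v = Node j \<Longrightarrow> j \<le> k" "1 \<le> k"
  shows "v \<notin> summands n c m"
  using assms(1)
proof (induction m rule: dec_induct)
  case base
  then show ?case using assms(2) .
next
  case (step m)
  then show ?case
    using summands_step[of "Suc m" n c] assms(3)[of "Suc m"] assms(4) by auto
qed

lemma child_in_summands:
  assumes "summation_order n c" "(v, Node k) \<in> child_rel n c"
  shows "2 \<le> k" "k \<le> n" "v \<in> summands n c (k - 1)" "v \<notin> summands n c k"
proof -
  have k: "2 \<le> k" "k \<le> n" and v: "v = fst (c k) \<or> v = snd (c k)"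
    using assms(2) by (auto simp: child_rel_def)
  show "2 \<le> k" "k \<le> n" by fact+
  show S: "v \<in> summands n c (k - 1)"
    using summation_order_children[OF assms(1) k] v by auto
  then have "v \<noteq> Node k"
    using Node_in_summands_index[of k n c "k - 1"] k by auto
  then show "v \<notin> summands n c k"
    using summands_step[OF k(1)] v by auto
qed

text \<open>A child of \<open>Node k\<close> leaves the summands in step \<open>k\<close>, so no later step can select it again.\<close>

lemma parent_unique:
  assumes "summation_order n c" "(v, Node k) \<in> child_rel n c" "(v, Node l) \<in> child_rel n c"
  shows "k = l"
proof -
  have no_later_parent: "\<not> k < l"
    if "(v, Node k) \<in> child_rel n c" "(v, Node l) \<in> child_rel n c" for k l
  proof
    assume "k < l"
    note k = child_in_summands[OF assms(1) that(1)] and l = child_in_summands[OF assms(1) that(2)]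
    have "j \<le> k" if "v = Node j" for j
      using Node_in_summands_index[of j n c "k - 1"] k that by auto
    then have "v \<notin> summands n c (l - 1)"
      using removed_summand_stays_removed[of k "l - 1" v n c] \<open>k < l\<close> k by simp
    with l show False by simp
  qed
  from no_later_parent[OF assms(2,3)] no_later_parent[OF assms(3,2)] show ?thesis by simp
qed

lemma ancestor_index_greater:
  assumes "summation_order n c" "(v, w) \<in> (child_rel n c)\<^sup>+"
  shows "\<exists>k\<le>n. w = Node k \<and> (\<forall>j. v = Node j \<longrightarrow> j < k)"
  using assms(2)
proof (induction rule: trancl_induct)
  case (base w)
  then obtain k where w: "w = Node k" by (auto simp: child_rel_def)
  note k = child_in_summands[OF assms(1) base[unfolded w]]
  have "j < k" if "v = Node j" for j
    using Node_in_summands_index[of j n c "k - 1"] k that by auto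
  then show ?case using w k by blast
next
  case (step w z)
  then obtain k where z: "z = Node k" by (auto simp: child_rel_def)
  note k = child_in_summands[OF assms(1) step.hyps(2)[unfolded z]]
  obtain i where i: "w = Node i" "\<forall>j. v = Node j \<longrightarrow> j < i"
    using step.IH by blast
  have "i < k"
    using Node_in_summands_index[of i n c "k - 1"] k i(1) by auto
  with i(2) have "\<forall>j. v = Node j \<longrightarrow> j < k"
    using less_trans by blast
  then show ?case using z k by blast
qed

text \<open>A summand either survives the next step or becomes a child of the new summand, so every
  summand leads to the single final summand \<open>Node n\<close>.\<close>

lemma summand_below_root:
  assumes "summation_order n c" "2 \<le> n" "m \<le> n"
  shows "1 \<le> m \<Longrightarrow> v \<in> summands n c m \<Longrightarrow> (v, Node n) \<in> (child_rel n c)\<^sup>*"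
  using assms(3)
proof (induction m arbitrary: v rule: inc_induct)
  case base
  then show ?case using final_summands[OF assms(1,2)] by simp
next
  case (step m)
  have S: "summands n c (Suc m) =
      insert (Node (Suc m)) (summands n c m - {fst (c (Suc m)), snd (c (Suc m))})"
    using summands_step[of "Suc m" n c] step by simp
  show ?case
  proof (cases "v \<in> summands n c (Suc m)")
    case True
    then show ?thesis using step by simp
  next
    case False
    then have "(v, Node (Suc m)) \<in> child_rel n c"
      using S step by (auto simp: child_rel_def)
    moreover have "(Node (Suc m), Node n) \<in> (child_rel n c)\<^sup>*"
      using S step by simp
    ultimately show ?thesis by (rule converse_rtrancl_into_rtrancl)
  qed
qed

lemma node_below_root:
  assumes "summation_order n c" "2 \<le> j" "j \<le> n"
  shows "descendant_eq n c j n"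
proof -
  have "(Node j, Node n) \<in> (child_rel n c)\<^sup>*"
    using summand_below_root[OF assms(1), of j "Node j"] summands_step[OF assms(2), of n c] assms
    by auto
  then show ?thesis by (auto simp: descendant_eq_def descendant_def rtrancl_eq_or_trancl)
qed

definition ancestors :: "nat \<Rightarrow> schedule \<Rightarrow> vertex \<Rightarrow> nat set" where
  "ancestors n c v = {j\<in>{2..n}. (v, Node j) \<in> (child_rel n c)\<^sup>+}"

lemma ancestors_child:
  assumes "summation_order n c" "(v, Node k) \<in> child_rel n c"
  shows "ancestors n c v = insert k (ancestors n c (Node k))"
proof -
  have "(v, Node j) \<in> (child_rel n c)\<^sup>+ \<longleftrightarrow> j = k \<or> (Node k, Node j) \<in> (child_rel n c)\<^sup>+" for j
  proof
    assume "(v, Node j) \<in> (child_rel n c)\<^sup>+"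
    then obtain w where w: "(v, w) \<in> child_rel n c" "(w, Node j) \<in> (child_rel n c)\<^sup>*"
      by (auto dest: tranclD)
    then obtain l where "w = Node l" by (auto simp: child_rel_def)
    with w parent_unique[OF assms] have "w = Node k" by blast
    with w(2) show "j = k \<or> (Node k, Node j) \<in> (child_rel n c)\<^sup>+"
      by (auto simp: rtrancl_eq_or_trancl)
  next
    assume "j = k \<or> (Node k, Node j) \<in> (child_rel n c)\<^sup>+"
    then show "(v, Node j) \<in> (child_rel n c)\<^sup>+"
      using assms(2) by (auto intro: trancl_into_trancl2)
  qed
  then show ?thesis
    using child_in_summands[OF assms] by (auto simp: ancestors_def)
qed

definition amplification :: "nat \<Rightarrow> schedule \<Rightarrow> (nat \<Rightarrow> real) \<Rightarrow> vertex \<Rightarrow> real" where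
  "amplification n c \<delta> v = (\<Prod>j\<in>ancestors n c v. 1 + \<delta> j)"

lemma amplification_child:
  assumes "summation_order n c" "(v, Node k) \<in> child_rel n c"
  shows "amplification n c \<delta> v = (1 + \<delta> k) * amplification n c \<delta> (Node k)"
proof -
  have "k \<notin> ancestors n c (Node k)"
    using ancestor_index_greater[OF assms(1), of "Node k" "Node k"] by (auto simp: ancestors_def)
  moreover have "finite (ancestors n c (Node k))" by (simp add: ancestors_def)
  ultimately show ?thesis by (simp add: amplification_def ancestors_child[OF assms])
qed

lemma amplification_root:
  assumes "summation_order n c"
  shows "amplification n c \<delta> (Node n) = 1"
proof -
  have "ancestors n c (Node n) = {}"
    using ancestor_index_greater[OF assms, of "Node n"] by (force simp: ancestors_def)
  then show ?thesis by (simp add: amplification_def)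
qed

text \<open>The amplification of a child contains the factor \<open>1 + \<delta> k\<close> by which step \<open>k\<close> multiplies the
  inherited error. Replacing the two children by their sum therefore leaves the weighted total
  unchanged, except for the rounding error committed in the step itself.\<close>

lemma amplified_error_total:
  assumes ord: "summation_order n c"
    and ex: "exact_sums n c x s" and comp: "computed_sums n c u x \<delta> s'"
  shows "1 \<le> m \<Longrightarrow> m \<le> n \<Longrightarrow>
    (\<Sum>v\<in>summands n c m. (vertex_value x s' v - vertex_value x s v) * amplification n c \<delta> v) =
    (\<Sum>k=2..m. s k * \<delta> k * amplification n c \<delta> (Node k))"
proof (induction m rule: dec_induct)
  case base
  \<comment> \<open>The initial summands are the inputs, which are stored exactly.\<close>
  then show ?case by (auto intro!: sum.neutral)
next
  case (step m)
  let ?k = "Suc m"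
  let ?S = "summands n c m" and ?a = "fst (c ?k)" and ?b = "snd (c ?k)"
  let ?e = "\<lambda>v. vertex_value x s' v - vertex_value x s v"
  let ?W = "amplification n c \<delta>"
  have k: "2 \<le> ?k" "?k \<le> n" using step by auto
  have ab: "?a \<in> ?S" "?b \<in> ?S" "?a \<noteq> ?b"
    using summation_order_children[OF ord k] by auto
  have new: "Node ?k \<notin> ?S"
    using Node_in_summands_index[of "Suc m" n c m] by auto
  have W: "?W ?a = (1 + \<delta> ?k) * ?W (Node ?k)" "?W ?b = (1 + \<delta> ?k) * ?W (Node ?k)"
    using k by (auto intro!: amplification_child[OF ord] simp: child_rel_def)
  have "s ?k = vertex_value x s ?a + vertex_value x s ?b"
    using ex k by (auto simp: exact_sums_def)
  moreover have "s' ?k = (vertex_value x s' ?a + vertex_value x s' ?b) * (1 + \<delta> ?k)"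
    using comp k by (auto simp: computed_sums_def)
  ultimately have e: "?e (Node ?k) = (?e ?a + ?e ?b) * (1 + \<delta> ?k) + s ?k * \<delta> ?k"
    by (simp add: algebra_simps)
  have eW: "?e (Node ?k) * ?W (Node ?k) =
      ?e ?a * ?W ?a + ?e ?b * ?W ?b + s ?k * \<delta> ?k * ?W (Node ?k)"
    unfolding W e by (simp add: algebra_simps)
  have "(\<Sum>v\<in>summands n c ?k. ?e v * ?W v) =
      ?e (Node ?k) * ?W (Node ?k) + (\<Sum>v\<in>?S - {?a, ?b}. ?e v * ?W v)"
    using summands_step[OF k(1), of n c] new finite_summands[of n c m] by simp
  also have "(\<Sum>v\<in>?S - {?a, ?b}. ?e v * ?W v) =
      (\<Sum>v\<in>?S. ?e v * ?W v) - (?e ?a * ?W ?a + ?e ?b * ?W ?b)"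
    using ab finite_summands[of n c m] by (subst sum_diff) auto
  finally have "(\<Sum>v\<in>summands n c ?k. ?e v * ?W v) =
      (\<Sum>v\<in>?S. ?e v * ?W v) + s ?k * \<delta> ?k * ?W (Node ?k)"
    using eW by linarith
  then show ?case using step k by simp
qed

theorem lemma2p2:
  fixes n :: nat and c :: schedule and u :: real and x s s' \<delta> :: "nat \<Rightarrow> real"
  assumes "n \<ge> 2"
    and "0 < u" and "u < 1"
    and "summation_order n c"
    and "exact_sums n c x s"
    and "computed_sums n c u x \<delta> s'"
  shows "s' n - s n =
    (\<Sum>k=2..n. s k * \<delta> k * (\<Prod>j\<in>{j\<in>{2..n}. descendant n c k j \<and> descendant_eq n c j n}. 1 + \<delta> j))"
proof -
  have "{j\<in>{2..n}. descendant n c k j \<and> descendant_eq n c j n} = ancestors n c (Node k)" for k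
    using node_below_root[OF assms(4)] by (auto simp: ancestors_def descendant_def)
  then have "(\<Prod>j\<in>{j\<in>{2..n}. descendant n c k j \<and> descendant_eq n c j n}. 1 + \<delta> j) =
      amplification n c \<delta> (Node k)" for k
    by (simp add: amplification_def)
  moreover have "s' n - s n = (\<Sum>k=2..n. s k * \<delta> k * amplification n c \<delta> (Node k))"
    using amplified_error_total[OF assms(4-6), of n] assms(1)
    by (simp add: final_summands[OF assms(4,1)] amplification_root[OF assms(4)])
  ultimately show ?thesis by simp
qed

end
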